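(* Consider one step of the explicit scheme $$f_i^{n+1}=f_i^n+\Delta t\,\frac{\mathcal F^n_{i+1/2}-\mathcal F^n_{i-1/2}}{\Delta w},\qquad i=0,\dots,N,\qquad \mathcal F^n_{-1/2}=\mathcal F^n_{N+1/2}=0,$$ where for $i=0,\dots,N-1$ $$\mathcal F^n_{i+1/2}=\tilde{\mathcal C}^n_{i+1/2}\left[(1-\delta^n_{i+1/2})f^n_{i+1}+\delta^n_{i+1/2}f^n_i\right]+D_{i+1/2}\frac{f^n_{i+1}-f^n_i}{\Delta w},$$ with $\tilde{\mathcal C}^n_{i+1/2},\delta^n_{i+1/2}$ as defined in the context. Let $$M=\max_{0\le i\le N-1}|\tilde{\mathcal C}^n_{i+1/2}|,\qquad \bar D=\max_{0\le i\le N-1}D_{i+1/2}.$$ If $\Delta t>0$ satisfies $$\Delta t\le\frac{\Delta w^2}{2(M\Delta w+\bar D)},$$ then the scheme preserves nonnegativity: if $f_i^n\ge 0$ for all $i=0,\dots,N$, then $f_i^{n+1}\ge 0$ for all $i=0,\dots,N$.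
   Context: The scheme discretizes $\partial_t f=\partial_w\left[(\mathcal B[f]+D')f+D\,\partial_w f\right]$ in one dimension. Grid: $w_0<\dots<w_N$ with uniform spacing $w_{i+1}-w_i=\Delta w>0$, $w_{i+1/2}=w_i+\Delta w/2$. The diffusion function $D\ge0$ is continuously differentiable and strictly positive at interior points of the computational domain, $D'=\partial_wD$, $D_{i+1/2}=D(w_{i+1/2})>0$. At time level $n$, $\mathcal B^n(w)=\mathcal B[f^n](w)$ is a given real-valued function of $w$ determined by the known values $f^n$. For $i=0,\dots,N-1$, $$\lambda^n_{i+1/2}=\int_{w_i}^{w_{i+1}}\frac{\mathcal B^n(w)+D'(w)}{D(w)}\,dw,\qquad \tilde{\mathcal C}^n_{i+1/2}=\frac{D_{i+1/2}}{\Delta w}\lambda^n_{i+1/2},\qquad \delta^n_{i+1/2}=\frac{1}{\lambda^n_{i+1/2}}+\frac{1}{1-\exp(\lambda^n_{i+1/2})},$$ where the integrals are assumed finite, and $\delta^n_{i+1/2}=1/2$ (the continuous extension) if $\lambda^n_{i+1/2}=0$. *)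

theory Defs
  imports "HOL-Analysis.Analysis"
begin

(* Half-integer indices are encoded by the node to their left: index i stands for i + 1/2.
   The arguments are the nodes w, the spacing dw, the diffusion D with derivative D', and the
   drift B frozen at the current time level. *)

definition D_half :: "(real \<Rightarrow> real) \<Rightarrow> (nat \<Rightarrow> real) \<Rightarrow> real \<Rightarrow> nat \<Rightarrow> real" where
  "D_half D w dw i = D (w i + dw / 2)"

(* D may vanish at the end points of the domain, so the integral may be improper there; the
   gauge integral covers Lebesgue as well as convergent improper Riemann integrals. *)
definition lambda_half ::
    "(real \<Rightarrow> real) \<Rightarrow> (real \<Rightarrow> real) \<Rightarrow> (real \<Rightarrow> real) \<Rightarrow> (nat \<Rightarrow> real) \<Rightarrow> nat \<Rightarrow> real" where
  "lambda_half D D' B w i = integral {w i..w (Suc i)} (\<lambda>x. (B x + D' x) / D x)"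

definition C_half ::
    "(real \<Rightarrow> real) \<Rightarrow> (real \<Rightarrow> real) \<Rightarrow> (real \<Rightarrow> real) \<Rightarrow> (nat \<Rightarrow> real) \<Rightarrow> real \<Rightarrow> nat \<Rightarrow> real" where
  "C_half D D' B w dw i = D_half D w dw i / dw * lambda_half D D' B w i"

definition delta_half ::
    "(real \<Rightarrow> real) \<Rightarrow> (real \<Rightarrow> real) \<Rightarrow> (real \<Rightarrow> real) \<Rightarrow> (nat \<Rightarrow> real) \<Rightarrow> nat \<Rightarrow> real" where
  "delta_half D D' B w i =
     (let l = lambda_half D D' B w i
      in if l = 0 then 1 / 2 else 1 / l + 1 / (1 - exp l))"

definition inner_flux ::
    "(real \<Rightarrow> real) \<Rightarrow> (real \<Rightarrow> real) \<Rightarrow> (real \<Rightarrow> real) \<Rightarrow> (nat \<Rightarrow> real) \<Rightarrow> real \<Rightarrow>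
     (nat \<Rightarrow> real) \<Rightarrow> nat \<Rightarrow> real" where
  "inner_flux D D' B w dw u i =
     C_half D D' B w dw i *
       ((1 - delta_half D D' B w i) * u (Suc i) + delta_half D D' B w i * u i)
     + D_half D w dw i * ((u (Suc i) - u i) / dw)"

(* Fluxes through the right face i + 1/2 and the left face i - 1/2 of cell i, for 0 \<le> i \<le> N,
   with no flux through the faces -1/2 and N + 1/2. *)

definition right_flux ::
    "nat \<Rightarrow> (real \<Rightarrow> real) \<Rightarrow> (real \<Rightarrow> real) \<Rightarrow> (real \<Rightarrow> real) \<Rightarrow> (nat \<Rightarrow> real) \<Rightarrow> real \<Rightarrow>
     (nat \<Rightarrow> real) \<Rightarrow> nat \<Rightarrow> real" where
  "right_flux N D D' B w dw u i = (if i < N then inner_flux D D' B w dw u i else 0)"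

definition left_flux ::
    "nat \<Rightarrow> (real \<Rightarrow> real) \<Rightarrow> (real \<Rightarrow> real) \<Rightarrow> (real \<Rightarrow> real) \<Rightarrow> (nat \<Rightarrow> real) \<Rightarrow> real \<Rightarrow>
     (nat \<Rightarrow> real) \<Rightarrow> nat \<Rightarrow> real" where
  "left_flux N D D' B w dw u i = (if i = 0 then 0 else right_flux N D D' B w dw u (i - 1))"

end

(*
  Writing l for lambda, the flux through the face i + 1/2 is D_{i+1/2} / dw times
  (1 + l (1 - delta)) f_{i+1} - (1 - l delta) f_i. Since 0 <= delta <= 1, and since
  1 - l delta = l / (exp l - 1) and 1 + l (1 - delta) = l exp l / (exp l - 1), both weights lie
  between 0 and 1 + |l|. Hence the neighbours contribute nonnegatively to f_i at the next time
  level, while each of the two faces removes at most dt / dw * (M + Dbar / dw) * f_i.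
*)

theory Submission
  imports Defs
begin

text \<open>The bounds on \<open>d\<close> are the inequality \<open>exp x \<ge> 1 + x\<close> taken
  at \<open>l\<close> and at \<open>- l\<close>. The signs of the two flux weights follow because
  \<open>l\<close> and \<open>1 - exp l\<close> have opposite signs.\<close>

lemma delta_half_bounds:
  fixes D D' B :: "real \<Rightarrow> real" and w :: "nat \<Rightarrow> real" and i :: nat
  defines "l \<equiv> lambda_half D D' B w i" and "d \<equiv> delta_half D D' B w i"
  shows "0 \<le> d" "d \<le> 1" "0 \<le> 1 - l * d" "0 \<le> 1 + l * (1 - d)"
proof -
  have "0 \<le> d \<and> d \<le> 1 \<and> 0 \<le> 1 - l * d \<and> 0 \<le> 1 + l * (1 - d)"
  proof (cases "l = 0")
    case True
    then show ?thesis
      by (simp add: d_def delta_half_def flip: l_def)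
  next
    case False
    define e where "e = exp l"
    have ne: "1 - e \<noteq> 0"
      using False by (simp add: e_def)
    have d: "d = 1 / l + 1 / (1 - e)"
      using False by (simp add: d_def delta_half_def Let_def e_def flip: l_def)
    \<comment> \<open>This is the common denominator of \<open>d\<close>; being negative, it
      reverses the inequalities between numerators below.\<close>
    have neg: "l * (1 - e) < 0"
      using False by (cases "l > 0") (auto simp: mult_less_0_iff e_def)
    have d': "d = (1 + l - e) / (l * (1 - e))"
      unfolding d add_frac_eq[OF False ne] by (simp add: algebra_simps)
    have "1 + l - e \<le> 0"
      using exp_ge_add_one_self[of l] by (simp add: e_def)
    then have "0 \<le> d"
      using neg by (simp add: d' divide_nonpos_neg)
    moreover have "d \<le> 1"
    proof -
      have "e * (1 - l) \<le> e * exp (- l)"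
        using exp_ge_add_one_self[of "- l"] by (intro mult_left_mono) (simp_all add: e_def)
      then have "e * (1 - l) \<le> 1"
        by (simp add: e_def exp_minus)
      then have "l * (1 - e) \<le> 1 + l - e"
        by (simp add: algebra_simps)
      then show ?thesis
        using neg by (simp add: d' neg_divide_le_eq)
    qed
    \<comment> \<open>In terms of \<open>q\<close> the two weights are
      \<open>1 - l * d = - q\<close> and \<open>1 + l * (1 - d) = - e * q\<close>, so
      \<open>q \<le> 0\<close> settles both.\<close>
    moreover define q where "q = l / (1 - e)"
    have "q * (1 - e) = l"
      using ne by (simp add: q_def)
    then have l_eq: "l = q - e * q"
      by (simp add: algebra_simps)
    have "q \<le> 0"
      using neg by (auto simp: q_def mult_less_0_iff divide_le_0_iff)
    have ld: "l * d = 1 + q"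
      using False by (simp add: d distrib_left q_def)
    moreover have "l * (1 - d) = - 1 - e * q"
      unfolding right_diff_distrib ld using l_eq by linarith
    moreover have "e * q \<le> 0"
      using \<open>q \<le> 0\<close> by (simp add: e_def mult_le_0_iff)
    moreover note \<open>q \<le> 0\<close>
    ultimately show ?thesis
      by simp
  qed
  then show "0 \<le> d" "d \<le> 1" "0 \<le> 1 - l * d" "0 \<le> 1 + l * (1 - d)"
    by auto
qed

text \<open>Each bound drops the term of the flux whose sign is favourable and estimates the weight
  of the other. The first limits what cell \<open>i\<close> loses through its right face, the second
  what cell \<open>Suc i\<close> loses through its left face.\<close>

lemma inner_flux_bounds:
  fixes D D' B :: "real \<Rightarrow> real" and w u :: "nat \<Rightarrow> real" and i :: nat and dw :: real
  defines "K \<equiv> \<bar>C_half D D' B w dw i\<bar> + D_half D w dw i / dw"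
  assumes dw: "dw > 0" and D: "D_half D w dw i \<ge> 0" and u: "u i \<ge> 0" "u (Suc i) \<ge> 0"
  shows "- (K * u i) \<le> inner_flux D D' B w dw u i"
    and "inner_flux D D' B w dw u i \<le> K * u (Suc i)"
proof -
  define l where "l = lambda_half D D' B w i"
  define d where "d = delta_half D D' B w i"
  define r where "r = D_half D w dw i / dw"
  have r: "r \<ge> 0"
    using dw D by (simp add: r_def)
  have K: "K = r * (1 + \<bar>l\<bar>)"
    using r by (simp add: K_def C_half_def abs_mult algebra_simps flip: r_def l_def)
  have flux: "inner_flux D D' B w dw u i = r * ((1 + l * (1 - d)) * u (Suc i) - (1 - l * d) * u i)"
    by (simp add: inner_flux_def C_half_def r_def l_def d_def add_divide_distrib diff_divide_distrib
          algebra_simps)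
  have d: "0 \<le> d" "d \<le> 1" "0 \<le> 1 - l * d" "0 \<le> 1 + l * (1 - d)"
    using delta_half_bounds unfolding l_def d_def by blast+
  \<comment> \<open>Both \<open>d\<close> and \<open>1 - d\<close> lie in [0, 1], so each weight
    differs from 1 by at most \<open>\<bar>l\<bar>\<close>; this matches the factor in
    \<open>K\<close>.\<close>
  have "\<bar>l * d\<bar> \<le> \<bar>l\<bar>" "\<bar>l * (1 - d)\<bar> \<le> \<bar>l\<bar>"
    using d by (auto simp: abs_mult intro!: mult_left_le)
  then have le: "1 - l * d \<le> 1 + \<bar>l\<bar>" "1 + l * (1 - d) \<le> 1 + \<bar>l\<bar>"
    by linarith+
  have "(1 - l * d) * u i \<le> (1 + \<bar>l\<bar>) * u i" "0 \<le> (1 + l * (1 - d)) * u (Suc i)"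
    using le d u by (simp_all add: mult_right_mono)
  then have "r * (- ((1 + \<bar>l\<bar>) * u i)) \<le> inner_flux D D' B w dw u i"
    unfolding flux by (intro mult_left_mono r) linarith
  then show "- (K * u i) \<le> inner_flux D D' B w dw u i"
    by (simp add: K mult.assoc)
  have "(1 + l * (1 - d)) * u (Suc i) \<le> (1 + \<bar>l\<bar>) * u (Suc i)" "0 \<le> (1 - l * d) * u i"
    using le d u by (simp_all add: mult_right_mono)
  then have "inner_flux D D' B w dw u i \<le> r * ((1 + \<bar>l\<bar>) * u (Suc i))"
    unfolding flux by (intro mult_left_mono r) linarith
  then show "inner_flux D D' B w dw u i \<le> K * u (Suc i)"
    by (simp add: K mult.assoc)
qed

lemma uniform_grid_node:
  fixes w :: "nat \<Rightarrow> real"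
  assumes "\<And>i. i < N \<Longrightarrow> w (Suc i) - w i = dw" "i \<le> N"
  shows "w i = w 0 + real i * dw"
  using assms(2)
proof (induction i)
  case (Suc i)
  then show ?case
    using assms(1)[of i] by (simp add: algebra_simps)
qed simp

theorem proposition1:
  fixes N n :: nat
    and w :: "nat \<Rightarrow> real"
    and dw dt M Dbar :: real
    and D D' :: "real \<Rightarrow> real"
    and B :: "(nat \<Rightarrow> real) \<Rightarrow> real \<Rightarrow> real"
    and f :: "nat \<Rightarrow> nat \<Rightarrow> real"
  assumes "N \<ge> 1"
    and "dw > 0"
    and grid: "\<And>i. i < N \<Longrightarrow> w (Suc i) - w i = dw"
    and D_nonneg: "\<And>x. x \<in> {w 0..w N} \<Longrightarrow> D x \<ge> 0"
    and D_deriv: "\<And>x. x \<in> {w 0..w N} \<Longrightarrow> (D has_real_derivative D' x) (at x within {w 0..w N})"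
    and D'_cont: "continuous_on {w 0..w N} D'"
    and D_pos: "\<And>x. x \<in> {w 0<..<w N} \<Longrightarrow> D x > 0"
    and integrals_finite:
      "\<And>i. i < N \<Longrightarrow> (\<lambda>x. (B (f n) x + D' x) / D x) integrable_on {w i..w (Suc i)}"
    and scheme: "\<And>i. i \<le> N \<Longrightarrow>
      f (Suc n) i = f n i + dt * ((right_flux N D D' (B (f n)) w dw (f n) i
                                   - left_flux N D D' (B (f n)) w dw (f n) i) / dw)"
    and M: "M = (MAX i\<in>{..<N}. \<bar>C_half D D' (B (f n)) w dw i\<bar>)"
    and Dbar: "Dbar = (MAX i\<in>{..<N}. D_half D w dw i)"
    and "dt > 0"
    and "dt \<le> dw\<^sup>2 / (2 * (M * dw + Dbar))"
    and nonneg: "\<And>i. i \<le> N \<Longrightarrow> f n i \<ge> 0"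
  shows "\<forall>i\<le>N. f (Suc n) i \<ge> 0"
proof (intro allI impI)
  fix i assume i: "i \<le> N"
  \<comment> \<open>A loss rate valid for every face. As \<open>K * dw = M * dw + Dbar\<close>, the
    restriction on \<open>dt\<close> says \<open>dt * (2 * K) \<le> dw\<close>.\<close>
  define K where "K = M + Dbar / dw"
  have D_half_pos: "0 < D_half D w dw j" if "j < N" for j
  proof -
    have "w j = w 0 + real j * dw" "w N = w 0 + real N * dw"
      by (rule uniform_grid_node[where N = N]; use grid that in \<open>blast intro: less_imp_le\<close>)+
    \<comment> \<open>The midpoint of a cell lies strictly inside the domain, where \<open>D\<close>
      is positive even if it vanishes at the ends.\<close>
    moreover have "(1 + real j) * dw \<le> real N * dw"
      using that \<open>dw > 0\<close> by (intro mult_right_mono) linarith+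
    moreover have "0 \<le> real j * dw"
      using \<open>dw > 0\<close> by simp
    ultimately have "w j + dw / 2 \<in> {w 0<..<w N}"
      unfolding greaterThanLessThan_iff distrib_right using \<open>dw > 0\<close> by linarith
    then show ?thesis
      unfolding D_half_def by (rule D_pos)
  qed
  have K_ge: "\<bar>C_half D D' (B (f n)) w dw j\<bar> + D_half D w dw j / dw \<le> K" if "j < N" for j
  proof -
    have "\<bar>C_half D D' (B (f n)) w dw j\<bar> \<le> M" "D_half D w dw j \<le> Dbar"
      unfolding M Dbar using that by (auto intro!: Max_ge)
    then show ?thesis
      using \<open>dw > 0\<close> by (auto simp: K_def intro!: add_mono divide_right_mono)
  qed
  have K_pos: "K > 0"
  proof -
    have "0 < D_half D w dw 0 / dw"
      using D_half_pos[of 0] \<open>N \<ge> 1\<close> \<open>dw > 0\<close> by simp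
    then show ?thesis
      using K_ge[of 0] \<open>N \<ge> 1\<close> by linarith
  qed
  have u: "0 \<le> f n i"
    using nonneg i by blast
  have right: "- (K * f n i) \<le> right_flux N D D' (B (f n)) w dw (f n) i"
  proof (cases "i < N")
    case True
    have "(\<bar>C_half D D' (B (f n)) w dw i\<bar> + D_half D w dw i / dw) * f n i \<le> K * f n i"
      using K_ge[OF True] u by (rule mult_right_mono)
    then show ?thesis
      using inner_flux_bounds(1)[of dw D w i "f n" D' "B (f n)"] D_half_pos[OF True] True
        \<open>dw > 0\<close> nonneg by (simp add: right_flux_def)
  next
    \<comment> \<open>A boundary face carries no flux, and zero satisfies the bound since
      \<open>K\<close> and \<open>f n i\<close> are nonnegative.\<close>
    case False
    then show ?thesis
      using K_pos u by (simp add: right_flux_def)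
  qed
  have left: "left_flux N D D' (B (f n)) w dw (f n) i \<le> K * f n i"
  proof (cases i)
    case 0
    then show ?thesis
      using K_pos u by (simp add: left_flux_def)
  next
    \<comment> \<open>The left face of cell \<open>i\<close> has index \<open>j\<close>, so cell
      \<open>i\<close> is the right neighbour in that flux and the upper bound applies.\<close>
    case (Suc j)
    then have j: "j < N"
      using i by simp
    have "(\<bar>C_half D D' (B (f n)) w dw j\<bar> + D_half D w dw j / dw) * f n i \<le> K * f n i"
      using K_ge[OF j] u by (rule mult_right_mono)
    then show ?thesis
      using inner_flux_bounds(2)[of dw D w j "f n" D' "B (f n)"] D_half_pos[OF j] j Suc
        \<open>dw > 0\<close> nonneg by (simp add: left_flux_def right_flux_def)
  qed
  have "dw\<^sup>2 / (2 * (M * dw + Dbar)) = dw / (2 * K)"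
    using \<open>dw > 0\<close> by (simp add: K_def field_simps power2_eq_square)
  then have "dt * (2 * K) \<le> dw"
    using \<open>dt \<le> _\<close> K_pos by (simp add: pos_le_divide_eq)
  then have cfl: "dt / dw * (2 * K) \<le> 1"
    using \<open>dw > 0\<close> by simp
  \<comment> \<open>The worst case: both faces remove the maximal amount, which is where the factor
    2 in the restriction on \<open>dt\<close> comes from.\<close>
  have "0 \<le> f n i * (1 - dt / dw * (2 * K))"
    using u cfl by simp
  also have "\<dots> = f n i + dt / dw * (- (K * f n i) - K * f n i)"
    by (simp add: algebra_simps)
  also have "\<dots> \<le> f n i + dt / dw * (right_flux N D D' (B (f n)) w dw (f n) i
                                      - left_flux N D D' (B (f n)) w dw (f n) i)"
    using right left \<open>dt > 0\<close> \<open>dw > 0\<close> by (intro add_left_mono mult_left_mono diff_mono) simp_all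
  also have "\<dots> = f (Suc n) i"
    using scheme[OF i] by simp
  finally show "0 \<le> f (Suc n) i" .
qed

end
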